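(* Let $a(t)>0$ be a scale factor, i.e. let $(a,\rho,p)$ be a solution on $[t_0,\infty)$, $t_0>0$, of the three Friedmann equations $$\left(\frac{\dot a}{a}\right)^2=\frac{8\pi G}{3}\rho-\frac{kc^2}{a^2},\qquad \frac{\ddot a}{a}=-\frac{4\pi G}{3}\left(\rho+\frac{3p}{c^2}\right),\qquad \dot\rho+3\frac{\dot a}{a}\left(\rho+\frac{p}{c^2}\right)=0,$$ and let $\mu(t)=\frac{4\pi G}{3}t^2\left(\rho(t)+\frac{3p(t)}{c^2}\right)$. Then: 1. If $\mu\in\mathcal M_\Gamma$ with $\Gamma<1/4$, then there are a root $\alpha\in\mathbb R$ of the polynomial $x^2-x+\Gamma$ and a normalized slowly varying function $L\in\mathcal N$ such that $a(t)=t^\alpha L(t)$. 2. If $\alpha\in\mathbb R$ and there is $L\in\mathcal N$ such that $a(t)=t^\alpha L(t)$, then there is $\Gamma\in\mathbb R$ such that $\mu\in\mathcal M_\Gamma$, $\alpha^2-\alpha+\Gamma=0$ and $\Gamma\le 1/4$.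
   Context: $G,c>0$ are constants and $k\in\{1,0,-1\}$. All functions are real-valued and continuous with sufficiently many derivatives (at least, $a$ has a continuous second derivative). By the second Friedmann equation, $\ddot a+\frac{\mu(t)}{t^2}a=0$. $\mathcal Z_0$ is the class of functions $\varepsilon$ with $\lim_{t\to+\infty}\varepsilon(t)=0$. $\mathcal N$ is the class of normalized slowly varying functions: $L\in\mathcal N$ iff there are a constant $h>0$, a number $b>0$ and $\varepsilon\in\mathcal Z_0$ with $L(x)=h\exp\left(\int_b^x\frac{\varepsilon(t)}{t}\,dt\right)$ for $x\ge b$. The equality $a(t)=t^\alpha L(t)$ is understood for all sufficiently large $t$. For $r\in\mathbb R$, $\mathcal M_r$ is the class of (continuous) functions $u$ for which the (improper) integrals below converge and $\lim_{x\to\infty}x\int_x^\infty\frac{u(t)}{t^2}\,dt=r$. *)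

theory Defs
  imports "HOL-Analysis.Analysis"
begin

text \<open>
  Functions on a half-line are modelled by total functions \<open>real \<Rightarrow> real\<close> whose values
  outside the half-line are irrelevant. Derivatives are taken within \<open>{t0..}\<close>, hence
  one-sided at \<open>t0\<close>.

  A triple \<open>(a, \<rho>, p)\<close> solving the three Friedmann equations, with \<open>a\<close> twice
  continuously differentiable. Here \<open>a'\<close>, \<open>a''\<close>, \<open>\<rho>'\<close> are the time derivatives,
  which on \<open>{t0..}\<close> are uniquely determined by \<open>a\<close> and \<open>\<rho>\<close>.
\<close>

definition friedmann_solution ::
  "real \<Rightarrow> real \<Rightarrow> int \<Rightarrow> real \<Rightarrow> (real \<Rightarrow> real) \<Rightarrow> (real \<Rightarrow> real) \<Rightarrow> (real \<Rightarrow> real) \<Rightarrow> bool"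
where
  "friedmann_solution G c k t0 a \<rho> p \<longleftrightarrow>
    (\<exists>a' a'' \<rho>'.
      (\<forall>t\<ge>t0. (a has_real_derivative a' t) (at t within {t0..})) \<and>
      (\<forall>t\<ge>t0. (a' has_real_derivative a'' t) (at t within {t0..})) \<and>
      (\<forall>t\<ge>t0. (\<rho> has_real_derivative \<rho>' t) (at t within {t0..})) \<and>
      continuous_on {t0..} a'' \<and> continuous_on {t0..} p \<and>
      (\<forall>t\<ge>t0. (a' t / a t)\<^sup>2 = 8 * pi * G / 3 * \<rho> t - of_int k * c\<^sup>2 / (a t)\<^sup>2) \<and>
      (\<forall>t\<ge>t0. a'' t / a t = - (4 * pi * G / 3) * (\<rho> t + 3 * p t / c\<^sup>2)) \<and>
      (\<forall>t\<ge>t0. \<rho>' t + 3 * (a' t / a t) * (\<rho> t + p t / c\<^sup>2) = 0))"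

definition friedmann_mu :: "real \<Rightarrow> real \<Rightarrow> (real \<Rightarrow> real) \<Rightarrow> (real \<Rightarrow> real) \<Rightarrow> real \<Rightarrow> real"
where
  "friedmann_mu G c \<rho> p t = 4 * pi * G / 3 * t\<^sup>2 * (\<rho> t + 3 * p t / c\<^sup>2)"

definition Z0 :: "(real \<Rightarrow> real) set" where
  "Z0 = {\<epsilon>. (\<epsilon> \<longlongrightarrow> 0) at_top}"

text \<open>Normalized slowly varying functions; the factor \<open>h\<close> is a constant.\<close>

definition NSV :: "(real \<Rightarrow> real) set" where
  "NSV = {L. \<exists>h>0. \<exists>b>0. \<exists>\<epsilon>\<in>Z0. continuous_on {b..} \<epsilon> \<and>
              (\<forall>x\<ge>b. L x = h * exp (integral {b..x} (\<lambda>t. \<epsilon> t / t)))}"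

text \<open>
  The improper integral over \<open>{x..}\<close> as a limit of integrals over compact intervals, so
  that conditional convergence is allowed (unlike for a Lebesgue integral over \<open>{x..}\<close>).
\<close>

definition has_improper_integral :: "(real \<Rightarrow> real) \<Rightarrow> real \<Rightarrow> real \<Rightarrow> bool" where
  "has_improper_integral f x I \<longleftrightarrow>
    (\<forall>y\<ge>x. f integrable_on {x..y}) \<and> ((\<lambda>y. integral {x..y} f) \<longlongrightarrow> I) at_top"

text \<open>In the next definition \<open>J x\<close> is the integral of \<open>u t / t\<^sup>2\<close> over \<open>{x..}\<close>.\<close>

definition M_class :: "real \<Rightarrow> (real \<Rightarrow> real) set" where
  "M_class r = {u. \<exists>x0>0. continuous_on {x0..} u \<and>
      (\<exists>J. (\<forall>x\<ge>x0. has_improper_integral (\<lambda>t. u t / t\<^sup>2) x (J x)) \<and>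
           ((\<lambda>x. x * J x) \<longlongrightarrow> r) at_top)}"

end

theory Submission
  imports Defs
begin

text \<open>
  The Hubble function \<open>w = a' / a\<close> solves the Riccati equation \<open>w' + w\<^sup>2 = - \<mu> / t\<^sup>2\<close>, and
  \<open>a = t powr \<alpha> * L\<close> with \<open>L\<close> normalized slowly varying iff \<open>t * w t \<longlonglongrightarrow> \<alpha>\<close>. Put
  \<open>J x = \<integral>\<^sub>x\<^sup>\<infinity> \<mu> / t\<^sup>2\<close>. If \<open>x * J x\<close> tends to \<open>\<Gamma> < 1/4\<close>, then \<open>U = t * (w - J) + \<Gamma>\<close> satisfies
  \<open>t * U' = - (U - \<alpha>\<^sub>1) * (U - \<alpha>\<^sub>2)\<close> up to a vanishing perturbation, where \<open>\<alpha>\<^sub>1 < \<alpha>\<^sub>2\<close> are the roots of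
  \<open>x\<^sup>2 - x + \<Gamma>\<close>; as \<open>U\<close> cannot run off to \<open>-\<infinity>\<close> (the solution would blow up in finite time),
  it converges to one of the roots. Conversely, if \<open>t * w t \<longlonglongrightarrow> \<alpha>\<close>, integrating the Riccati equation
  gives \<open>x * J x = x * w x - x * \<integral>\<^sub>x\<^sup>\<infinity> w\<^sup>2\<close>, which tends to \<open>\<alpha> - \<alpha>\<^sup>2\<close>.
\<close>

section \<open>Barrier arguments and scalar flows with two equilibria\<close>

text \<open>If \<open>g\<close> were below \<open>c\<close> at time \<open>t\<close>, let
  \<open>s\<close> be the last time in \<open>{T..t}\<close> with \<open>c \<le> g s\<close>. The
  intermediate value theorem gives \<open>g s = c\<close>, and the positive derivative there keeps
  \<open>g\<close> above \<open>c\<close> for a moment longer, against the choice of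
  \<open>s\<close>.\<close>

lemma stays_above_level:
  fixes g g' :: "real \<Rightarrow> real"
  assumes der: "\<And>t. t \<ge> T \<Longrightarrow> (g has_real_derivative g' t) (at t)"
    and pos: "\<And>t. t \<ge> T \<Longrightarrow> g t = c \<Longrightarrow> g' t > 0"
    and "c \<le> g T" and "T \<le> t"
  shows "c \<le> g t"
proof (rule ccontr)
  assume below: "\<not> c \<le> g t"
  have cont: "continuous_on {T..t} g"
    by (intro continuous_at_imp_continuous_on ballI DERIV_isCont[OF der]) auto
  define S where "S = {s \<in> {T..t}. c \<le> g s}"
  have "compact S"
    unfolding compact_eq_bounded_closed
  proof
    show "bounded S" by (rule bounded_subset[OF bounded_closed_interval[of T t]]) (auto simp: S_def)
    show "closed S"
      using continuous_on_closed_Collect_le[OF continuous_on_const cont closed_atLeastAtMost]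
      by (simp add: S_def)
  qed
  moreover have "T \<in> S" using assms by (auto simp: S_def)
  ultimately obtain s where s: "s \<in> S" "\<And>r. r \<in> S \<Longrightarrow> r \<le> s"
    by (metis compact_attains_sup empty_iff)
  have "s < t" using s(1) below by (auto simp: S_def less_le)
  have "continuous_on {s..t} g"
    using s(1) by (intro continuous_on_subset[OF cont]) (auto simp: S_def)
  then obtain x where x: "s \<le> x" "x \<le> t" "g x = c"
    using IVT2'[of g t c s] s(1) below by (auto simp: S_def)
  then have "x \<in> S" using s(1) by (auto simp: S_def)
  with x s(2) have gs: "g s = c" by force
  have "T \<le> s" using s(1) by (auto simp: S_def)
  from DERIV_pos_inc_right[OF der[OF this] pos[OF this gs]] obtain d
    where d: "d > 0" "\<And>h. 0 < h \<Longrightarrow> h < d \<Longrightarrow> g s < g (s + h)" by blast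
  define h where "h = min (d / 2) (t - s)"
  have h: "0 < h" "h < d" "s + h \<le> t" using d \<open>s < t\<close> by (auto simp: h_def)
  with d(2) gs have "c < g (s + h)" by auto
  with h \<open>T \<le> s\<close> have "s + h \<in> S" by (auto simp: S_def)
  with s(2) h show False by force
qed

text \<open>Inside the band from \<open>c\<close> to \<open>e\<close> the slope of \<open>g\<close>
  is at least \<open>\<kappa> / t\<close>, so \<open>g\<close> gains at least as much as
  \<open>\<kappa> * ln t\<close>. Since \<open>ln\<close> is unbounded, \<open>g\<close> must reach
  \<open>e\<close>. The levels \<open>c\<close> and \<open>e\<close> both act as barriers:
  \<open>g\<close> leaves the band only upwards and does not return below \<open>e\<close>.\<close>

lemma eventually_above_level:
  fixes g g' :: "real \<Rightarrow> real"
  assumes der: "\<And>t. t \<ge> T \<Longrightarrow> (g has_real_derivative g' t) (at t)"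
    and "T > 0" "\<kappa> > 0" "c \<le> e" "c \<le> g T"
    and grow: "\<And>t. t \<ge> T \<Longrightarrow> c \<le> g t \<Longrightarrow> g t \<le> e \<Longrightarrow> \<kappa> \<le> t * g' t"
  shows "\<forall>\<^sub>F t in at_top. e \<le> g t"
proof -
  have pos: "g' t > 0" if "t \<ge> T" "c \<le> g t" "g t \<le> e" for t
    using grow[OF that] \<open>\<kappa> > 0\<close> \<open>T > 0\<close> that(1) by (smt (verit) mult_nonneg_nonpos)
  have above: "c \<le> g t" if "t \<ge> T" for t
    using stays_above_level[OF der, of T c t] pos assms that by auto
  have "\<exists>s\<ge>T. e \<le> g s"
  proof (rule ccontr)
    assume "\<not> ?thesis"
    then have below: "g t < e" if "t \<ge> T" for t using that by force
    have lower: "g T - \<kappa> * ln T \<le> g t - \<kappa> * ln t" if "t \<ge> T" for t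
    proof (rule DERIV_nonneg_imp_nondecreasing[OF that])
      fix x assume x: "T \<le> x" "x \<le> t"
      have "((\<lambda>t. g t - \<kappa> * ln t) has_real_derivative g' x - \<kappa> * (1 / x)) (at x)"
        using x \<open>T > 0\<close> by (auto intro!: derivative_eq_intros der)
      moreover have "0 \<le> g' x - \<kappa> * (1 / x)"
        using grow[OF x(1) above less_imp_le[OF below]] x \<open>T > 0\<close> by (auto simp: field_simps)
      ultimately show "\<exists>y. ((\<lambda>t. g t - \<kappa> * ln t) has_real_derivative y) (at x) \<and> 0 \<le> y"
        by blast
    qed
    have "filterlim (\<lambda>t. \<kappa> * ln t) at_top at_top"
      using \<open>\<kappa> > 0\<close> by (intro filterlim_tendsto_pos_mult_at_top[OF tendsto_const _ ln_at_top])
    then have "\<forall>\<^sub>F t in at_top. e - g T + \<kappa> * ln T \<le> \<kappa> * ln t"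
      by (auto simp: filterlim_at_top)
    then have "\<forall>\<^sub>F t in at_top. t \<ge> T \<and> e - g T + \<kappa> * ln T \<le> \<kappa> * ln t"
      using eventually_ge_at_top[of T] by eventually_elim auto
    then obtain t where "t \<ge> T" "e - g T + \<kappa> * ln T \<le> \<kappa> * ln t"
      using eventually_happens'[OF trivial_limit_at_top_linorder] by blast
    with lower[of t] below[of t] show False by auto
  qed
  then obtain s where s: "s \<ge> T" "e \<le> g s" by blast
  have "e \<le> g t" if "t \<ge> s" for t
    using stays_above_level[of s g g' e t] der pos s that \<open>c \<le> e\<close> by auto
  then show ?thesis by (auto simp: eventually_at_top_linorder)
qed

text \<open>
  The hypotheses say that, up to a vanishing perturbation, \<open>g\<close> follows a flow on the line with an
  unstable equilibrium \<open>\<alpha>\<^sub>1\<close> and a stable equilibrium \<open>\<alpha>\<^sub>2\<close>, in the logarithmic time \<open>ln t\<close>.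
\<close>

lemma two_equilibria_tendsto:
  fixes g g' :: "real \<Rightarrow> real"
  assumes der: "\<And>t. t > T \<Longrightarrow> (g has_real_derivative g' t) (at t)"
    and less: "\<alpha>\<^sub>1 < \<alpha>\<^sub>2"
    and bdd: "\<forall>\<^sub>F t in at_top. B \<le> g t"
    and drift: "\<And>\<eta>. \<eta> > 0 \<Longrightarrow> \<exists>\<kappa>>0. \<forall>\<^sub>F t in at_top.
      (\<alpha>\<^sub>2 + \<eta> \<le> g t \<longrightarrow> t * g' t \<le> - \<kappa>) \<and>
      (\<alpha>\<^sub>1 + \<eta> \<le> g t \<and> g t \<le> \<alpha>\<^sub>2 - \<eta> \<longrightarrow> \<kappa> \<le> t * g' t) \<and>
      (g t \<le> \<alpha>\<^sub>1 - \<eta> \<longrightarrow> t * g' t \<le> - \<kappa>)"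
  shows "(g \<longlongrightarrow> \<alpha>\<^sub>1) at_top \<or> (g \<longlongrightarrow> \<alpha>\<^sub>2) at_top"
proof -
  have drift': "\<exists>\<kappa> N. \<kappa> > 0 \<and> N > 0 \<and> N > T \<and> (\<forall>t\<ge>N.
      (\<alpha>\<^sub>2 + \<eta> \<le> g t \<longrightarrow> t * g' t \<le> - \<kappa>) \<and>
      (\<alpha>\<^sub>1 + \<eta> \<le> g t \<and> g t \<le> \<alpha>\<^sub>2 - \<eta> \<longrightarrow> \<kappa> \<le> t * g' t) \<and>
      (g t \<le> \<alpha>\<^sub>1 - \<eta> \<longrightarrow> t * g' t \<le> - \<kappa>))" if "\<eta> > 0" for \<eta>
  proof -
    from drift[OF that] obtain \<kappa> M where "\<kappa> > 0" and M: "\<forall>t\<ge>M.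
      (\<alpha>\<^sub>2 + \<eta> \<le> g t \<longrightarrow> t * g' t \<le> - \<kappa>) \<and>
      (\<alpha>\<^sub>1 + \<eta> \<le> g t \<and> g t \<le> \<alpha>\<^sub>2 - \<eta> \<longrightarrow> \<kappa> \<le> t * g' t) \<and>
      (g t \<le> \<alpha>\<^sub>1 - \<eta> \<longrightarrow> t * g' t \<le> - \<kappa>)"
      by (auto simp: eventually_at_top_linorder)
    then show ?thesis
      by (intro exI[of _ \<kappa>] exI[of _ "max M (max 1 (T + 1))"]) auto
  qed
  have der': "((\<lambda>t. - g t) has_real_derivative - g' t) (at t)" if "t > T" for t
    using der[OF that] by (rule DERIV_minus)
  have upper: "\<forall>\<^sub>F t in at_top. g t \<le> \<alpha>\<^sub>2 + \<eta>" if "\<eta> > 0" for \<eta>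
  proof -
    from drift'[OF that] obtain \<kappa> N where N: "\<kappa> > 0" "N > 0" "N > T"
      "\<And>t. t \<ge> N \<Longrightarrow> \<alpha>\<^sub>2 + \<eta> \<le> g t \<Longrightarrow> t * g' t \<le> - \<kappa>" by blast
    \<comment> \<open>The minimum puts the lower end of the band for \<open>- g\<close> below both
      the starting value and the target, wherever \<open>g N\<close> lies.\<close>
    have "\<forall>\<^sub>F t in at_top. - (\<alpha>\<^sub>2 + \<eta>) \<le> - g t"
      using N by (intro eventually_above_level[where T = N and \<kappa> = \<kappa>
            and c = "min (- g N) (- (\<alpha>\<^sub>2 + \<eta>))" and g' = "\<lambda>t. - g' t"] der')
        (auto, force)
    then show ?thesis by eventually_elim simp
  qed
  show ?thesis
  \<comment> \<open>Either \<open>g\<close> eventually stays below every level above the unstable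
    equilibrium, and then it tends to \<open>\<alpha>\<^sub>1\<close>, or it exceeds one such level
    at arbitrarily late times and is carried up to \<open>\<alpha>\<^sub>2\<close>.\<close>
  proof (cases "\<forall>\<eta>>0. \<forall>\<^sub>F t in at_top. g t \<le> \<alpha>\<^sub>1 + \<eta>")
    case True
    have lower: "\<forall>\<^sub>F t in at_top. \<alpha>\<^sub>1 - \<eta> \<le> g t" if "\<eta> > 0" for \<eta>
    proof (rule ccontr)
      assume not_ev: "\<not> ?thesis"
      from drift'[OF that] obtain \<kappa> N where N: "\<kappa> > 0" "N > 0" "N > T"
        "\<And>t. t \<ge> N \<Longrightarrow> g t \<le> \<alpha>\<^sub>1 - \<eta> \<Longrightarrow> t * g' t \<le> - \<kappa>" by blast
      from not_ev obtain s where s: "s \<ge> N" "g s < \<alpha>\<^sub>1 - \<eta>"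
        by (force simp: eventually_at_top_linorder not_le)
      \<comment> \<open>Once below \<open>\<alpha>\<^sub>1 - \<eta>\<close>, \<open>g\<close> is
        pushed down without end. The level \<open>1 - B\<close> for \<open>- g\<close> means
        \<open>g t \<le> B - 1\<close>, which contradicts the lower bound \<open>B\<close>.\<close>
      have "\<forall>\<^sub>F t in at_top. max (- g s) (1 - B) \<le> - g t"
      proof (rule eventually_above_level[where T = s and \<kappa> = \<kappa>
              and c = "- g s" and g' = "\<lambda>t. - g' t"])
        fix t assume "s \<le> t" "- g s \<le> - g t"
        then show "\<kappa> \<le> t * - g' t" using N(4)[of t] s by simp
      qed (use N s in \<open>auto intro!: der'\<close>)
      from eventually_happens'[OF trivial_limit_at_top_linorder eventually_conj[OF bdd this]]
      show False by auto
    qed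
    have "(g \<longlongrightarrow> \<alpha>\<^sub>1) at_top"
    proof (rule tendstoI)
      fix \<eta> :: real assume "\<eta> > 0"
      with True have "\<forall>\<^sub>F t in at_top. g t \<le> \<alpha>\<^sub>1 + \<eta> / 2" by (auto dest: spec[of _ "\<eta> / 2"])
      moreover have "\<forall>\<^sub>F t in at_top. \<alpha>\<^sub>1 - \<eta> / 2 \<le> g t" using lower[of "\<eta> / 2"] \<open>\<eta> > 0\<close> by simp
      ultimately show "\<forall>\<^sub>F t in at_top. dist (g t) \<alpha>\<^sub>1 < \<eta>"
        by eventually_elim (use \<open>\<eta> > 0\<close> in \<open>auto simp: dist_real_def abs_less_iff\<close>)
    qed
    then show ?thesis ..
  next
    case False
    then obtain \<eta>\<^sub>0 where \<eta>\<^sub>0: "\<eta>\<^sub>0 > 0" "\<not> (\<forall>\<^sub>F t in at_top. g t \<le> \<alpha>\<^sub>1 + \<eta>\<^sub>0)" by blast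
    have lower: "\<forall>\<^sub>F t in at_top. \<alpha>\<^sub>2 - \<eta> \<le> g t" if "\<eta> > 0" for \<eta>
    proof -
      \<comment> \<open>The three bounds serve the conclusion, the starting value above
        \<open>\<alpha>\<^sub>1 + \<eta>\<^sub>0\<close>, and the order of the two ends of the
        band.\<close>
      define \<eta>' where "\<eta>' = min \<eta> (min \<eta>\<^sub>0 ((\<alpha>\<^sub>2 - \<alpha>\<^sub>1) / 2))"
      have \<eta>': "\<eta>' > 0" "\<eta>' \<le> \<eta>" "\<eta>' \<le> \<eta>\<^sub>0" "\<alpha>\<^sub>1 + \<eta>' \<le> \<alpha>\<^sub>2 - \<eta>'"
        using that \<eta>\<^sub>0 less by (auto simp: \<eta>'_def min_def field_simps)
      from drift'[OF \<eta>'(1)] obtain \<kappa> N where N: "\<kappa> > 0" "N > 0" "N > T"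
        "\<And>t. t \<ge> N \<Longrightarrow> \<alpha>\<^sub>1 + \<eta>' \<le> g t \<Longrightarrow> g t \<le> \<alpha>\<^sub>2 - \<eta>' \<Longrightarrow> \<kappa> \<le> t * g' t" by blast
      from \<eta>\<^sub>0(2) obtain s where s: "s \<ge> N" "\<alpha>\<^sub>1 + \<eta>\<^sub>0 < g s"
        by (force simp: eventually_at_top_linorder not_le)
      have "\<forall>\<^sub>F t in at_top. \<alpha>\<^sub>2 - \<eta>' \<le> g t"
        using N s \<eta>' by (intro eventually_above_level[where T = s and \<kappa> = \<kappa>
              and c = "\<alpha>\<^sub>1 + \<eta>'" and g' = g'] der) auto
      then show ?thesis by eventually_elim (use \<eta>' in auto)
    qed
    have "(g \<longlongrightarrow> \<alpha>\<^sub>2) at_top"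
    proof (rule tendstoI)
      fix \<eta> :: real assume "\<eta> > 0"
      then have "\<forall>\<^sub>F t in at_top. g t \<le> \<alpha>\<^sub>2 + \<eta> / 2" "\<forall>\<^sub>F t in at_top. \<alpha>\<^sub>2 - \<eta> / 2 \<le> g t"
        using upper[of "\<eta> / 2"] lower[of "\<eta> / 2"] by simp_all
      then show "\<forall>\<^sub>F t in at_top. dist (g t) \<alpha>\<^sub>2 < \<eta>"
        by eventually_elim (use \<open>\<eta> > 0\<close> in \<open>auto simp: dist_real_def abs_less_iff\<close>)
    qed
    then show ?thesis ..
  qed
qed

section \<open>Asymptotics of the Riccati equation\<close>

lemma tendsto_zero_of_times_ident:
  fixes f :: "real \<Rightarrow> real"
  assumes "((\<lambda>x. x * f x) \<longlongrightarrow> l) at_top"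
  shows "(f \<longlongrightarrow> 0) at_top"
proof -
  have "((\<lambda>x. x * f x * inverse x) \<longlongrightarrow> l * 0) at_top"
    by (intro tendsto_mult assms tendsto_inverse_0_at_top filterlim_ident)
  moreover have "\<forall>\<^sub>F x in at_top. x * f x * inverse x = f x"
    using eventually_gt_at_top[of 0] by eventually_elim auto
  ultimately have "(f \<longlongrightarrow> l * 0) at_top" by (rule Lim_transform_eventually)
  then show ?thesis by simp
qed

text \<open>The difference \<open>z = w - J\<close> has derivative \<open>- w\<^sup>2\<close>, so
  once negative it stays below some \<open>- m\<close>. As \<open>J\<close> vanishes at infinity,
  eventually \<open>w \<le> z / 2 < 0\<close>, hence \<open>z' \<le> - z\<^sup>2 / 4\<close>. This
  forces a blow-up in finite time, although \<open>w\<close> and \<open>J\<close> exist for all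
  \<open>t > T\<close>.\<close>

lemma riccati_remainder_nonneg:
  fixes w J q :: "real \<Rightarrow> real"
  assumes w: "\<And>t. t > T \<Longrightarrow> (w has_real_derivative - q t - (w t)\<^sup>2) (at t)"
    and J: "\<And>t. t > T \<Longrightarrow> (J has_real_derivative - q t) (at t)"
    and lim: "(J \<longlongrightarrow> 0) at_top"
    and "s > T"
  shows "J s \<le> w s"
proof (rule ccontr)
  assume below: "\<not> J s \<le> w s"
  define z where "z = (\<lambda>t. w t - J t)"
  define m where "m = - z s"
  have m: "m > 0" using below by (simp add: m_def z_def)
  have z: "(z has_real_derivative - (w t)\<^sup>2) (at t)" if "t > T" for t
    using DERIV_diff[OF w J, OF that that] by (simp add: z_def)
  have mono: "z t \<le> - m" if "t \<ge> s" for t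
    unfolding m_def minus_minus
  proof (rule DERIV_nonpos_imp_nonincreasing[OF that])
    fix x assume "s \<le> x"
    then show "\<exists>y. (z has_real_derivative y) (at x) \<and> y \<le> 0"
      using z[of x] \<open>s > T\<close> by (intro exI[of _ "- (w x)\<^sup>2"]) auto
  qed
  have "\<forall>\<^sub>F t in at_top. J t < m / 2" using m by (intro order_tendstoD[OF lim]) simp
  then obtain N where N: "\<And>t. t \<ge> N \<Longrightarrow> J t < m / 2" by (auto simp: eventually_at_top_linorder)
  define r where "r = max N s"
  have r: "z t \<le> - m" "J t < m / 2" "t > T" if "t \<ge> r" for t
    using that mono N \<open>s > T\<close> by (auto simp: r_def)
  \<comment> \<open>The finite-time blow-up: \<open>1 / z\<close> is negative but grows at rate at least \<open>1/4\<close>.\<close>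
  have grow: "1 / z r - r / 4 \<le> 1 / z t - t / 4" if "t \<ge> r" for t
  proof (rule DERIV_nonneg_imp_nondecreasing[OF that])
    fix x assume x: "r \<le> x" "x \<le> t"
    have neg: "z x < 0" using r(1)[OF x(1)] m by simp
    have "(z x / 2)\<^sup>2 \<le> (w x)\<^sup>2"
      unfolding abs_le_square_iff[symmetric]
      using r(1,2)[OF x(1)] m by (auto simp: z_def)
    then have "0 \<le> (w x)\<^sup>2 / (z x)\<^sup>2 - 1 / 4"
      using neg by (simp add: field_simps power2_eq_square)
    moreover have "((\<lambda>t. 1 / z t - t / 4) has_real_derivative (w x)\<^sup>2 / (z x)\<^sup>2 - 1 / 4) (at x)"
      using neg by (auto intro!: derivative_eq_intros z r(3)[OF x(1)] simp: power2_eq_square)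
    ultimately show "\<exists>y. ((\<lambda>t. 1 / z t - t / 4) has_real_derivative y) (at x) \<and> 0 \<le> y"
      by blast
  qed
  \<comment> \<open>By time \<open>r - 4 / z r\<close>, growth at rate \<open>1/4\<close> has lifted
    \<open>1 / z\<close> from \<open>1 / z r\<close> to at least \<open>0\<close>.\<close>
  define t where "t = max r (r - 4 / z r)"
  have "r \<le> t" "- (1 / z r) \<le> (t - r) / 4" by (auto simp: t_def)
  moreover have "1 / z t < 0" using r(1)[OF \<open>r \<le> t\<close>] m by simp
  ultimately show False using grow[OF \<open>r \<le> t\<close>] by (simp add: diff_divide_distrib)
qed

text \<open>Only the tail \<open>J\<close> is controlled, not \<open>q\<close> itself. Subtracting
  \<open>J\<close> from \<open>w\<close> cancels \<open>q\<close> in the derivative, so the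
  perturbation left in the equation for \<open>U\<close> is just
  \<open>d = t * J t - \<Gamma>\<close>, which vanishes at infinity.\<close>

lemma riccati_tendsto_root:
  fixes w J q :: "real \<Rightarrow> real"
  assumes w: "\<And>t. t > T \<Longrightarrow> (w has_real_derivative - q t - (w t)\<^sup>2) (at t)"
    and J: "\<And>t. t > T \<Longrightarrow> (J has_real_derivative - q t) (at t)"
    and lim: "((\<lambda>t. t * J t) \<longlongrightarrow> \<Gamma>) at_top"
    and "\<Gamma> < 1 / 4"
  shows "\<exists>\<alpha>. \<alpha>\<^sup>2 - \<alpha> + \<Gamma> = 0 \<and> ((\<lambda>t. t * w t) \<longlongrightarrow> \<alpha>) at_top"
proof -
  define D where "D = sqrt (1 - 4 * \<Gamma>)"
  have D: "D > 0" "D\<^sup>2 = 1 - 4 * \<Gamma>" using \<open>\<Gamma> < 1 / 4\<close> by (auto simp: D_def)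
  define \<alpha>\<^sub>1 \<alpha>\<^sub>2 where "\<alpha>\<^sub>1 = (1 - D) / 2" and "\<alpha>\<^sub>2 = (1 + D) / 2"
  have factor: "x\<^sup>2 - x + \<Gamma> = (x - \<alpha>\<^sub>1) * (x - \<alpha>\<^sub>2)" for x
    using D(2) by (simp add: \<alpha>\<^sub>1_def \<alpha>\<^sub>2_def field_simps power2_eq_square)
  have less: "\<alpha>\<^sub>1 < \<alpha>\<^sub>2" using D by (simp add: \<alpha>\<^sub>1_def \<alpha>\<^sub>2_def)
  define d where "d = (\<lambda>t. t * J t - \<Gamma>)"
  have d: "(d \<longlongrightarrow> 0) at_top" unfolding d_def using tendsto_diff[OF lim tendsto_const[of \<Gamma>]] by simp
  define U where "U = (\<lambda>t. t * (w t - J t) + \<Gamma>)"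
  have tw: "t * w t = U t + d t" for t by (simp add: U_def d_def algebra_simps)
  define U' where "U' = (\<lambda>t. (w t - J t) - t * (w t)\<^sup>2)"
  have U: "(U has_real_derivative U' t) (at t)" if "t > T" for t
    unfolding U_def U'_def
    by (auto intro!: derivative_eq_intros w[OF that] J[OF that] simp: algebra_simps)
  have tU': "t * U' t = - ((t * w t - \<alpha>\<^sub>1) * (t * w t - \<alpha>\<^sub>2)) - d t" for t
    unfolding factor[symmetric] U'_def d_def by (simp add: algebra_simps power2_eq_square)
  have J0: "(J \<longlongrightarrow> 0) at_top" by (rule tendsto_zero_of_times_ident[OF lim])
  have bdd: "\<forall>\<^sub>F t in at_top. \<Gamma> \<le> U t"
    using eventually_gt_at_top[of T] eventually_gt_at_top[of 0]
    by eventually_elim (use riccati_remainder_nonneg[OF w J J0] in \<open>auto simp: U_def\<close>)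
  have "(U \<longlongrightarrow> \<alpha>\<^sub>1) at_top \<or> (U \<longlongrightarrow> \<alpha>\<^sub>2) at_top"
  proof (rule two_equilibria_tendsto[OF U less bdd])
    fix \<eta> :: real assume \<eta>: "\<eta> > 0"
    have near: "\<forall>\<^sub>F t in at_top. \<bar>d t\<bar> < e" if "e > 0" for e
      using tendstoD[OF d that] by (simp add: dist_real_def)
    \<comment> \<open>The first bound keeps both factors of the quadratic in \<open>t * w t\<close>
      at size at least \<open>\<eta> / 2\<close>, so their product has size at least
      \<open>\<eta>\<^sup>2 / 4\<close>. The second makes the additive error consume at most half of
      this, leaving \<open>\<kappa> = \<eta>\<^sup>2 / 8\<close>.\<close>
    have ev: "\<forall>\<^sub>F t in at_top. \<bar>d t\<bar> < \<eta> / 2" "\<forall>\<^sub>F t in at_top. \<bar>d t\<bar> < \<eta>\<^sup>2 / 8"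
      by (rule near, use \<eta> in simp)+
    have prod: "\<eta>\<^sup>2 / 4 \<le> x * y" if "\<eta> / 2 \<le> x" "\<eta> / 2 \<le> y" for x y
      using mult_mono[OF that] \<eta> that by (simp add: power2_eq_square)
    show "\<exists>\<kappa>>0. \<forall>\<^sub>F t in at_top.
      (\<alpha>\<^sub>2 + \<eta> \<le> U t \<longrightarrow> t * U' t \<le> - \<kappa>) \<and>
      (\<alpha>\<^sub>1 + \<eta> \<le> U t \<and> U t \<le> \<alpha>\<^sub>2 - \<eta> \<longrightarrow> \<kappa> \<le> t * U' t) \<and>
      (U t \<le> \<alpha>\<^sub>1 - \<eta> \<longrightarrow> t * U' t \<le> - \<kappa>)"
    proof (intro exI[of _ "\<eta>\<^sup>2 / 8"] conjI)
      show "\<eta>\<^sup>2 / 8 > 0" using \<eta> by simp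
      show "\<forall>\<^sub>F t in at_top.
        (\<alpha>\<^sub>2 + \<eta> \<le> U t \<longrightarrow> t * U' t \<le> - (\<eta>\<^sup>2 / 8)) \<and>
        (\<alpha>\<^sub>1 + \<eta> \<le> U t \<and> U t \<le> \<alpha>\<^sub>2 - \<eta> \<longrightarrow> \<eta>\<^sup>2 / 8 \<le> t * U' t) \<and>
        (U t \<le> \<alpha>\<^sub>1 - \<eta> \<longrightarrow> t * U' t \<le> - (\<eta>\<^sup>2 / 8))"
        using ev
      proof eventually_elim
        case (elim t)
        have *: "\<eta>\<^sup>2 / 4 \<le> (t * w t - \<alpha>\<^sub>1) * (t * w t - \<alpha>\<^sub>2)" if "\<alpha>\<^sub>2 + \<eta> \<le> U t"
          using elim less that by (intro prod) (auto simp: tw)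
        have **: "\<eta>\<^sup>2 / 4 \<le> (t * w t - \<alpha>\<^sub>1) * (\<alpha>\<^sub>2 - t * w t)"
          if "\<alpha>\<^sub>1 + \<eta> \<le> U t" "U t \<le> \<alpha>\<^sub>2 - \<eta>"
          using elim less that by (intro prod) (auto simp: tw)
        have ***: "\<eta>\<^sup>2 / 4 \<le> (\<alpha>\<^sub>1 - t * w t) * (\<alpha>\<^sub>2 - t * w t)" if "U t \<le> \<alpha>\<^sub>1 - \<eta>"
          using elim less that by (intro prod) (auto simp: tw)
        show ?case
          unfolding tU' using * ** *** elim(2) by (auto simp: algebra_simps abs_less_iff)
      qed
    qed
  qed
  then obtain \<alpha> where \<alpha>: "\<alpha> \<in> {\<alpha>\<^sub>1, \<alpha>\<^sub>2}" "(U \<longlongrightarrow> \<alpha>) at_top" by blast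
  have "((\<lambda>t. t * w t) \<longlongrightarrow> \<alpha>) at_top"
    unfolding tw using tendsto_add[OF \<alpha>(2) d] by simp
  moreover have "\<alpha>\<^sup>2 - \<alpha> + \<Gamma> = 0" using \<alpha>(1) by (auto simp: factor)
  ultimately show ?thesis by blast
qed

section \<open>Improper integrals and their tails\<close>

lemma has_improper_integral_antiderivative:
  assumes "\<And>t. t \<ge> x \<Longrightarrow> (F has_real_derivative f t) (at t)" and "(F \<longlongrightarrow> A) at_top"
  shows "has_improper_integral f x (A - F x)"
proof -
  have int: "(f has_integral F y - F x) {x..y}" if "y \<ge> x" for y
    using that assms(1)
    by (intro fundamental_theorem_of_calculus)
      (auto simp: has_real_derivative_iff_has_vector_derivative[symmetric]
        intro: has_field_derivative_at_within)
  have "((\<lambda>y. F y - F x) \<longlongrightarrow> A - F x) at_top" by (intro tendsto_intros assms)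
  moreover have "\<forall>\<^sub>F y in at_top. F y - F x = integral {x..y} f"
    using eventually_ge_at_top[of x] by eventually_elim (simp add: integral_unique[OF int])
  ultimately show ?thesis
    unfolding has_improper_integral_def using int by (auto dest: Lim_transform_eventually)
qed

text \<open>Uniqueness of limits gives \<open>J y = J b - integral {b..y} f\<close>, which reduces
  the claim to the fundamental theorem of calculus on a compact interval.\<close>

lemma improper_integral_has_derivative:
  assumes J: "\<And>x. x \<ge> b \<Longrightarrow> has_improper_integral f x (J x)"
    and cont: "continuous_on {b..} f" and "x > b"
  shows "(J has_real_derivative - f x) (at x)"
proof -
  have eq: "J y = J b - integral {b..y} f" if "y \<ge> b" for y
  proof -
    have "((\<lambda>z. integral {b..z} f - integral {b..y} f) \<longlongrightarrow> J b - integral {b..y} f) at_top"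
      using J[of b] by (intro tendsto_intros) (auto simp: has_improper_integral_def)
    moreover have "\<forall>\<^sub>F z in at_top. integral {b..z} f - integral {b..y} f = integral {y..z} f"
      using eventually_ge_at_top[of y]
    proof eventually_elim
      case (elim z)
      have "f integrable_on {b..z}"
        using J[of b] elim that by (auto simp: has_improper_integral_def)
      from Henstock_Kurzweil_Integration.integral_combine[OF that elim this] show ?case by simp
    qed
    ultimately have "((\<lambda>z. integral {y..z} f) \<longlongrightarrow> J b - integral {b..y} f) at_top"
      by (rule Lim_transform_eventually)
    moreover have "((\<lambda>z. integral {y..z} f) \<longlongrightarrow> J y) at_top"
      using J[OF that] by (auto simp: has_improper_integral_def)
    ultimately show ?thesis using tendsto_unique trivial_limit_at_top_linorder by blast
  qed
  have "((\<lambda>y. integral {b..y} f) has_real_derivative f x) (at x within {b..x + 1})"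
    using \<open>x > b\<close> by (intro integral_has_real_derivative continuous_on_subset[OF cont]) auto
  moreover have "at x within {b..x + 1} = at x"
    using \<open>x > b\<close> by (intro at_within_interior) (auto simp: interior_atLeastAtMost_real)
  ultimately have "((\<lambda>y. J b - integral {b..y} f) has_real_derivative - f x) (at x)"
    by (auto intro!: derivative_eq_intros)
  moreover have "\<forall>\<^sub>F y in nhds x. J y = J b - integral {b..y} f"
    using eventually_nhds_in_open[of "{b<..}" x] \<open>x > b\<close>
    by (auto elim!: eventually_mono intro: eq)
  ultimately show ?thesis by (subst DERIV_cong_ev[OF refl _ refl]) auto
qed

text \<open>
  The substitution \<open>t = 1 / r\<close> turns \<open>\<integral>\<^sub>x\<^sup>\<infinity> u t / t\<^sup>2 dt\<close> into \<open>\<integral>\<^sub>0\<^bsup>1/x\<^esup> u (1 / r) dr\<close>, whose integrand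
  extends continuously to \<open>r = 0\<close> with value \<open>l\<close>.
\<close>

lemma inverse_square_tail:
  fixes u :: "real \<Rightarrow> real"
  assumes cont: "continuous_on {T..} u" and "T > 0" and lim: "(u \<longlongrightarrow> l) at_top"
  shows "\<exists>W. (\<forall>x>T. (W has_real_derivative - (u x / x\<^sup>2)) (at x)) \<and>
             (W \<longlongrightarrow> 0) at_top \<and> ((\<lambda>x. x * W x) \<longlongrightarrow> l) at_top"
proof -
  define g where "g = (\<lambda>r. if r \<le> 0 then l else u (1 / r))"
  have contg: "continuous_on {0..1 / T} g"
  proof (rule continuous_on_eq_continuous_within[THEN iffD2], rule ballI)
    fix r assume r: "r \<in> {0..1 / T}"
    show "continuous (at r within {0..1 / T}) g"
    proof (cases "r = 0")
      case True
      have "((\<lambda>r. u (inverse r)) \<longlongrightarrow> l) (at_right 0)"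
        by (rule filterlim_compose[OF lim filterlim_inverse_at_top_right])
      then have "(g \<longlongrightarrow> l) (at_right 0)"
        by (rule Lim_transform_eventually)
          (auto simp: g_def eventually_at_filter inverse_eq_divide)
      then have "(g \<longlongrightarrow> l) (at 0 within {0..1 / T})"
        using \<open>T > 0\<close> by (simp add: at_within_Icc_at_right)
      then show ?thesis using True by (simp add: continuous_within g_def)
    next
      case False
      have "continuous_on {0<..1 / T} (\<lambda>r. u (1 / r))"
        using \<open>T > 0\<close>
        by (intro continuous_on_compose2[OF cont] continuous_intros) (auto simp: field_simps)
      then have "continuous_on {0<..1 / T} g"
        by (rule continuous_on_eq) (auto simp: g_def)
      then have "(g \<longlongrightarrow> g r) (at r within {0<..1 / T})"
        using r False by (auto simp: continuous_on_def)
      moreover have "at r within {0..1 / T} = at r within {0<..1 / T}"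
        using r False by (intro at_within_nhd[of _ "{0<..}"]) auto
      ultimately show ?thesis by (simp add: continuous_within)
    qed
  qed
  define G where "G = (\<lambda>r. integral {0..r} g)"
  have G: "(G has_real_derivative g r) (at r within {0..1 / T})" if "r \<in> {0..1 / T}" for r
    unfolding G_def by (rule integral_has_real_derivative[OF contg that])
  define W where "W = (\<lambda>x. G (1 / x))"
  have "(W has_real_derivative - (u x / x\<^sup>2)) (at x)" if "x > T" for x
  proof -
    have r: "0 < 1 / x" "1 / x < 1 / T" using that \<open>T > 0\<close> by (auto simp: field_simps)
    then have "at (1 / x) within {0..1 / T} = at (1 / x)"
      by (intro at_within_interior) (auto simp: interior_atLeastAtMost_real)
    with G[of "1 / x"] r have "(G has_real_derivative u x) (at (1 / x))" by (auto simp: g_def)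
    moreover have "((\<lambda>x. 1 / x) has_real_derivative - (1 / x\<^sup>2)) (at x)"
      using that \<open>T > 0\<close> by (auto intro!: derivative_eq_intros simp: power2_eq_square)
    ultimately show ?thesis
      unfolding W_def using DERIV_chain2[of G "u x" "\<lambda>x. 1 / x" x] by fastforce
  qed
  moreover have xW: "((\<lambda>x. x * W x) \<longlongrightarrow> l) at_top"
  proof -
    \<comment> \<open>Since \<open>G 0 = 0\<close>, the one-sided derivative of \<open>G\<close> at
      \<open>0\<close> is the limit of \<open>G r / r\<close>, which is \<open>x * W x\<close> at
      \<open>r = 1 / x\<close>.\<close>
    have "(G has_real_derivative l) (at_right 0)"
      using G[of 0] \<open>T > 0\<close> by (simp add: at_within_Icc_at_right g_def)
    then have "((\<lambda>r. G r / r) \<longlongrightarrow> l) (at_right 0)"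
      by (simp add: has_field_derivative_iff G_def)
    then have "((\<lambda>x. G (inverse x) / inverse x) \<longlongrightarrow> l) at_top"
      by (rule filterlim_compose[OF _ filterlim_inverse_at_right_top])
    then show ?thesis by (simp add: W_def field_simps)
  qed
  moreover have "(W \<longlongrightarrow> 0) at_top" by (rule tendsto_zero_of_times_ident[OF xW])
  ultimately show ?thesis by blast
qed

section \<open>Normalized regular variation through the logarithmic derivative\<close>

text \<open>The two sides are linked by \<open>\<epsilon> t = t * (a' t / a t) - \<alpha>\<close>:
  then \<open>\<epsilon> t / t\<close> is the derivative of
  \<open>ln (a t) - \<alpha> * ln t\<close>. Differentiating the exponential representation gives
  one direction, integrating from \<open>b\<close> the other, with \<open>h\<close> the value of
  \<open>L\<close> at \<open>b\<close>.\<close>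

lemma normalized_regular_variation_iff:
  fixes a a' :: "real \<Rightarrow> real"
  assumes pos: "\<And>t. t > T \<Longrightarrow> a t > 0"
    and der: "\<And>t. t > T \<Longrightarrow> (a has_real_derivative a' t) (at t)"
    and cont: "continuous_on {T<..} a'"
  shows "(\<exists>L\<in>NSV. \<forall>\<^sub>F t in at_top. a t = t powr \<alpha> * L t) \<longleftrightarrow>
         ((\<lambda>t. t * (a' t / a t)) \<longlongrightarrow> \<alpha>) at_top"
proof
  assume "\<exists>L\<in>NSV. \<forall>\<^sub>F t in at_top. a t = t powr \<alpha> * L t"
  then obtain L N where "L \<in> NSV" and N: "\<And>t. t \<ge> N \<Longrightarrow> a t = t powr \<alpha> * L t"
    by (auto simp: eventually_at_top_linorder)
  then obtain h b \<epsilon> where h: "h > 0" and b: "b > 0" and \<epsilon>: "(\<epsilon> \<longlongrightarrow> 0) at_top"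
    and cont\<epsilon>: "continuous_on {b..} \<epsilon>"
    and L: "\<And>x. x \<ge> b \<Longrightarrow> L x = h * exp (integral {b..x} (\<lambda>t. \<epsilon> t / t))"
    unfolding NSV_def Z0_def by blast
  have eq: "t * (a' t / a t) = \<alpha> + \<epsilon> t" if t: "t > max b (max N T)" for t
  proof -
    define I where "I = (\<lambda>x. integral {b..x} (\<lambda>t. \<epsilon> t / t))"
    have "(I has_real_derivative \<epsilon> t / t) (at t within {b..t + 1})"
      unfolding I_def using t b
      by (intro integral_has_real_derivative continuous_intros continuous_on_subset[OF cont\<epsilon>]) auto
    moreover have "at t within {b..t + 1} = at t"
      using t by (intro at_within_interior) (auto simp: interior_atLeastAtMost_real)
    ultimately have I: "(I has_real_derivative \<epsilon> t / t) (at t)" by simp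
    have a_eq: "a x = x powr \<alpha> * (h * exp (I x))" if "x > max b N" for x
      using N[of x] L[of x] that by (simp add: I_def)
    have "t powr (\<alpha> - 1) = t powr \<alpha> / t" using t b by (simp add: powr_diff)
    then have "((\<lambda>x. x powr \<alpha> * (h * exp (I x))) has_real_derivative a t * ((\<alpha> + \<epsilon> t) / t)) (at t)"
      using t b by (auto intro!: derivative_eq_intros I simp: a_eq field_simps)
    moreover have "\<forall>\<^sub>F x in nhds t. a x = x powr \<alpha> * (h * exp (I x))"
      using eventually_nhds_in_open[of "{max b N<..}" t] t
      by (auto elim!: eventually_mono intro!: a_eq)
    ultimately have "(a has_real_derivative a t * ((\<alpha> + \<epsilon> t) / t)) (at t)"
      by (subst DERIV_cong_ev[OF refl _ refl]) auto
    moreover have "(a has_real_derivative a' t) (at t)" using t by (intro der) simp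
    ultimately have "a' t = a t * ((\<alpha> + \<epsilon> t) / t)" by (rule DERIV_unique[rotated])
    then show ?thesis using pos[of t] t b by (simp add: field_simps)
  qed
  have "\<forall>\<^sub>F t in at_top. \<alpha> + \<epsilon> t = t * (a' t / a t)"
    using eventually_gt_at_top[of "max b (max N T)"] by eventually_elim (rule eq[symmetric])
  moreover have "((\<lambda>t. \<alpha> + \<epsilon> t) \<longlongrightarrow> \<alpha>) at_top" using tendsto_add[OF tendsto_const \<epsilon>] by simp
  ultimately show "((\<lambda>t. t * (a' t / a t)) \<longlongrightarrow> \<alpha>) at_top"
    by (rule Lim_transform_eventually[rotated])
next
  assume lim: "((\<lambda>t. t * (a' t / a t)) \<longlongrightarrow> \<alpha>) at_top"
  define b where "b = max 1 (T + 1)"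
  have b: "b > 0" "b > T" by (auto simp: b_def)
  define \<epsilon> where "\<epsilon> = (\<lambda>t. t * (a' t / a t) - \<alpha>)"
  have "\<epsilon> \<in> Z0" using tendsto_diff[OF lim tendsto_const[of \<alpha>]] by (simp add: Z0_def \<epsilon>_def)
  have "continuous_on {b..} a"
    using b by (intro continuous_at_imp_continuous_on ballI DERIV_isCont[OF der]) auto
  then have cont\<epsilon>: "continuous_on {b..} \<epsilon>"
    unfolding \<epsilon>_def using b pos
    by (intro continuous_intros continuous_on_subset[OF cont]) (auto simp: less_imp_neq[symmetric])
  define L where "L = (\<lambda>x. a x * x powr (- \<alpha>))"
  define h where "h = L b"
  have L: "L x > 0" "ln (L x) = ln (a x) - \<alpha> * ln x" if "x \<ge> b" for x
    using pos[of x] b that by (auto simp: L_def ln_mult ln_powr)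
  then have "h > 0" by (simp add: h_def)
  have "L x = h * exp (integral {b..x} (\<lambda>t. \<epsilon> t / t))" if "x \<ge> b" for x
  proof -
    have "((\<lambda>t. \<epsilon> t / t) has_integral (ln (a x) - \<alpha> * ln x) - (ln (a b) - \<alpha> * ln b)) {b..x}"
    proof (intro fundamental_theorem_of_calculus that)
      fix t assume t: "t \<in> {b..x}"
      have "((\<lambda>t. ln (a t) - \<alpha> * ln t) has_real_derivative \<epsilon> t / t) (at t)"
        using t b pos[of t]
        by (auto intro!: derivative_eq_intros der simp: \<epsilon>_def field_simps)
      then show "((\<lambda>t. ln (a t) - \<alpha> * ln t) has_vector_derivative \<epsilon> t / t) (at t within {b..x})"
        by (auto simp: has_real_derivative_iff_has_vector_derivative[symmetric]
            intro: has_field_derivative_at_within)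
    qed
    then have "integral {b..x} (\<lambda>t. \<epsilon> t / t) = ln (L x) - ln h"
      using L(2)[OF that] L(2)[of b] by (simp add: h_def integral_unique)
    then show ?thesis
      using L(1)[OF that] \<open>h > 0\<close> by (simp add: exp_diff)
  qed
  with \<open>h > 0\<close> b(1) \<open>\<epsilon> \<in> Z0\<close> cont\<epsilon> have "L \<in> NSV" unfolding NSV_def by blast
  moreover have "\<forall>\<^sub>F t in at_top. a t = t powr \<alpha> * L t"
    using eventually_gt_at_top[of 0]
    by eventually_elim (auto simp: L_def powr_minus field_simps)
  ultimately show "\<exists>L\<in>NSV. \<forall>\<^sub>F t in at_top. a t = t powr \<alpha> * L t" by blast
qed

section \<open>From the Friedmann equations to the Riccati equation\<close>

theorem theorem3p2:
  fixes G c t0 :: real and k :: int and a \<rho> p :: "real \<Rightarrow> real"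
  assumes "G > 0" and "c > 0" and "k \<in> {1, 0, -1}" and "t0 > 0"
    and "\<forall>t\<ge>t0. a t > 0"
    and "friedmann_solution G c k t0 a \<rho> p"
  shows "(\<forall>\<Gamma>::real. friedmann_mu G c \<rho> p \<in> M_class \<Gamma> \<and> \<Gamma> < 1 / 4 \<longrightarrow>
            (\<exists>\<alpha>::real. \<alpha>\<^sup>2 - \<alpha> + \<Gamma> = 0 \<and>
               (\<exists>L\<in>NSV. \<forall>\<^sub>F t in at_top. a t = t powr \<alpha> * L t))) \<and>
         (\<forall>\<alpha>::real. (\<exists>L\<in>NSV. \<forall>\<^sub>F t in at_top. a t = t powr \<alpha> * L t) \<longrightarrow>
            (\<exists>\<Gamma>::real. friedmann_mu G c \<rho> p \<in> M_class \<Gamma> \<and>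
               \<alpha>\<^sup>2 - \<alpha> + \<Gamma> = 0 \<and> \<Gamma> \<le> 1 / 4))"
proof -
  define \<mu> where "\<mu> = friedmann_mu G c \<rho> p"
  from assms(6) obtain a' a'' where
    da: "\<And>t. t \<ge> t0 \<Longrightarrow> (a has_real_derivative a' t) (at t within {t0..})" and
    da': "\<And>t. t \<ge> t0 \<Longrightarrow> (a' has_real_derivative a'' t) (at t within {t0..})" and
    cont'': "continuous_on {t0..} a''" and
    F2: "\<And>t. t \<ge> t0 \<Longrightarrow> a'' t / a t = - (4 * pi * G / 3) * (\<rho> t + 3 * p t / c\<^sup>2)"
    unfolding friedmann_solution_def by metis
  have pos: "a t > 0" if "t > t0" for t using assms(5) that by simp
  have interior: "at t within {t0..} = at t" if "t > t0" for t
    using that by (intro at_within_interior) (auto simp: interior_real_atLeast)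
  have da: "(a has_real_derivative a' t) (at t)"
    and da': "(a' has_real_derivative a'' t) (at t)" if "t > t0" for t
    using da[of t] da'[of t] interior[OF that] that by auto
  have conta: "continuous_on {t0<..} a" and conta': "continuous_on {t0<..} a'"
    using da da' by (auto intro!: continuous_at_imp_continuous_on DERIV_isCont)
  define w where "w = (\<lambda>t. a' t / a t)"
  define q where "q = (\<lambda>t. \<mu> t / t\<^sup>2)"
  \<comment> \<open>This is the second Friedmann equation. It yields the continuity of
    \<open>q\<close> and \<open>\<mu>\<close> from that of \<open>a''\<close>, and the Riccati
    equation for \<open>w\<close>.\<close>
  have q: "q t = - (a'' t / a t)" if "t > t0" for t
    using F2[of t] that \<open>t0 > 0\<close> by (simp add: q_def \<mu>_def friedmann_mu_def)
  have "continuous_on {t0<..} (\<lambda>t. - (a'' t / a t))"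
    using pos by (intro continuous_intros conta continuous_on_subset[OF cont''])
      (auto simp: less_imp_neq[symmetric])
  then have contq: "continuous_on {t0<..} q" by (rule continuous_on_eq) (simp add: q)
  have "continuous_on {t0<..} (\<lambda>t. t\<^sup>2 * q t)" by (intro continuous_intros contq)
  then have cont\<mu>: "continuous_on {t0<..} \<mu>"
    by (rule continuous_on_eq) (use \<open>t0 > 0\<close> in \<open>auto simp: q_def\<close>)
  have contw: "continuous_on {t0<..} w"
    unfolding w_def using pos by (intro continuous_intros conta conta')
      (auto simp: less_imp_neq[symmetric])
  have dw: "(w has_real_derivative - q t - (w t)\<^sup>2) (at t)" if "t > t0" for t
    using pos[OF that]
    by (auto intro!: derivative_eq_intros da[OF that] da'[OF that]
        simp: w_def q[OF that] field_simps power2_eq_square)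
  have RV: "(\<exists>L\<in>NSV. \<forall>\<^sub>F t in at_top. a t = t powr \<alpha> * L t) \<longleftrightarrow>
      ((\<lambda>t. t * w t) \<longlongrightarrow> \<alpha>) at_top" for \<alpha>
    unfolding w_def by (rule normalized_regular_variation_iff[OF pos da conta'])
  show ?thesis
    unfolding RV \<mu>_def[symmetric]
  proof (intro conjI allI impI)
    fix \<Gamma> :: real assume "\<mu> \<in> M_class \<Gamma> \<and> \<Gamma> < 1 / 4"
    then obtain x0 J where J: "\<And>x. x \<ge> x0 \<Longrightarrow> has_improper_integral q x (J x)"
      and lim: "((\<lambda>x. x * J x) \<longlongrightarrow> \<Gamma>) at_top" and less: "\<Gamma> < 1 / 4"
      by (auto simp: M_class_def q_def)
    define T where "T = max x0 (t0 + 1)"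
    have dJ: "(J has_real_derivative - q t) (at t)" if "t > T" for t
      by (rule improper_integral_has_derivative[where f = q and b = T])
        (use that in \<open>auto intro!: J continuous_on_subset[OF contq] simp: T_def\<close>)
    show "\<exists>\<alpha>. \<alpha>\<^sup>2 - \<alpha> + \<Gamma> = 0 \<and> ((\<lambda>t. t * w t) \<longlongrightarrow> \<alpha>) at_top"
    proof (rule riccati_tendsto_root[OF _ dJ lim less])
      show "(w has_real_derivative - q t - (w t)\<^sup>2) (at t)" if "t > T" for t
        using that by (intro dw) (simp add: T_def)
    qed
  next
    fix \<alpha> :: real assume lim: "((\<lambda>t. t * w t) \<longlongrightarrow> \<alpha>) at_top"
    define T where "T = t0 + 1"
    have T: "T > 0" "T > t0" using \<open>t0 > 0\<close> by (auto simp: T_def)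
    \<comment> \<open>Writing \<open>w\<^sup>2\<close> as
      \<open>(t * w t)\<^sup>2 / t\<^sup>2\<close>, with a numerator tending to
      \<open>\<alpha>\<^sup>2\<close>, brings its tail integral \<open>W\<close> under
      \<open>inverse_square_tail\<close>.\<close>
    have "continuous_on {T..} (\<lambda>t. (t * w t)\<^sup>2)"
      using T by (intro continuous_intros continuous_on_subset[OF contw]) auto
    moreover have "((\<lambda>t. (t * w t)\<^sup>2) \<longlongrightarrow> \<alpha>\<^sup>2) at_top" by (intro tendsto_intros lim)
    ultimately obtain W where
      dW: "\<And>x. x > T \<Longrightarrow> (W has_real_derivative - ((x * w x)\<^sup>2 / x\<^sup>2)) (at x)" and
      W0: "(W \<longlongrightarrow> 0) at_top" and xW: "((\<lambda>x. x * W x) \<longlongrightarrow> \<alpha>\<^sup>2) at_top"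
      using inverse_square_tail[OF _ T(1)] by blast
    have w0: "(w \<longlongrightarrow> 0) at_top" by (rule tendsto_zero_of_times_ident[OF lim])
    \<comment> \<open>Both \<open>w'\<close> and \<open>W'\<close> contain
      \<open>- w\<^sup>2\<close>, which cancels: \<open>- J\<close> is an antiderivative of
      \<open>q\<close> that vanishes at infinity, so \<open>J x\<close> is the tail integral of
      \<open>q\<close>.\<close>
    define J where "J = (\<lambda>x. w x - W x)"
    have dJ: "((\<lambda>x. - J x) has_real_derivative q x) (at x)" if "x > T" for x
      using that T by (auto intro!: derivative_eq_intros dw dW simp: J_def power_mult_distrib)
    have "((\<lambda>x. - J x) \<longlongrightarrow> 0) at_top"
      unfolding J_def using tendsto_diff[OF W0 w0] by simp
    \<comment> \<open>The derivative of \<open>J\<close> is known only for \<open>x > T\<close>, so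
      the closed half-line starts at \<open>T + 1\<close>.\<close>
    then have "has_improper_integral q x (J x)" if "x \<ge> T + 1" for x
      using has_improper_integral_antiderivative[of x "\<lambda>x. - J x" q 0] dJ that by simp
    moreover have "((\<lambda>x. x * J x) \<longlongrightarrow> \<alpha> - \<alpha>\<^sup>2) at_top"
      unfolding J_def right_diff_distrib by (intro tendsto_intros lim xW)
    moreover have "continuous_on {T + 1..} \<mu>"
      using T by (intro continuous_on_subset[OF cont\<mu>]) auto
    ultimately have "\<mu> \<in> M_class (\<alpha> - \<alpha>\<^sup>2)"
      unfolding M_class_def q_def using T by (intro CollectI exI[of _ "T + 1"]) auto
    moreover have "\<alpha> - \<alpha>\<^sup>2 \<le> 1 / 4"
      using zero_le_power2[of "\<alpha> - 1 / 2"] by (simp add: power2_eq_square algebra_simps)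
    ultimately show "\<exists>\<Gamma>. \<mu> \<in> M_class \<Gamma> \<and> \<alpha>\<^sup>2 - \<alpha> + \<Gamma> = 0 \<and> \<Gamma> \<le> 1 / 4"
      by (intro exI[of _ "\<alpha> - \<alpha>\<^sup>2"]) auto
  qed
qed

end
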